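(* Let $R$ be a hemiring. The following statements are equivalent: (1) Each fuzzy $h$-ideal $\lambda$ of $R$ is idempotent, i.e. $\lambda\odot_h\lambda=\lambda$. (2) $\lambda\odot_h\mu=\lambda\wedge\mu$ for all fuzzy $h$-ideals $\lambda,\mu$ of $R$.
   Context: A hemiring is a set $R$ with operations $+$ and $\cdot$ such that $(R,+)$ is a commutative semigroup, $(R,\cdot)$ is a semigroup, multiplication distributes over addition on both sides, and there is $0\in R$ with $a+0=0+a=a$ and $a0=0a=0$ for all $a\in R$. A fuzzy subset of $R$ is a map $\lambda:R\to[0,1]$; $\wedge$ denotes (pointwise) minimum. A fuzzy $h$-ideal of $R$ is a fuzzy subset $\lambda$ such that for all $a,b,x,y\in R$: $\lambda(a+b)\geq\lambda(a)\wedge\lambda(b)$; $\lambda(ab)\geq\lambda(a)$ and $\lambda(ab)\geq\lambda(b)$; and $x+a+y=b+y$ implies $\lambda(x)\geq\lambda(a)\wedge\lambda(b)$. The $h$-intrinsic product of fuzzy subsets $\mu,\nu$ is $(\mu\odot_h\nu)(x)=\sup\big(\bigwedge_{i=1}^m(\mu(a_i)\wedge\nu(b_i))\wedge\bigwedge_{j=1}^n(\mu(a_j')\wedge\nu(b_j'))\big)$, the supremum being over all expressions $x+\sum_{i=1}^m a_ib_i+z=\sum_{j=1}^n a_j'b_j'+z$ with $m,n\geq1$ and $a_i,b_i,a_j',b_j',z\in R$, and $(\mu\odot_h\nu)(x)=0$ if no such expression exists. *)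

theory Defs
  imports Complex_Main
begin

text \<open>
  A hemiring, i.e. a commutative additive semigroup and a multiplicative semigroup with two-sided
  distributivity and an absorbing additive zero (no unit, no cancellation), is exactly an instance
  of the type class \<^class>\<open>semiring_0\<close>.
\<close>

definition fuzzy_subset :: "('a \<Rightarrow> real) \<Rightarrow> bool" where
  "fuzzy_subset l \<longleftrightarrow> (\<forall>x. 0 \<le> l x \<and> l x \<le> 1)"

definition fuzzy_h_ideal :: "('a::semiring_0 \<Rightarrow> real) \<Rightarrow> bool" where
  "fuzzy_h_ideal l \<longleftrightarrow> fuzzy_subset l \<and>
     (\<forall>a b. l (a + b) \<ge> min (l a) (l b)) \<and>
     (\<forall>a b. l (a * b) \<ge> l a \<and> l (a * b) \<ge> l b) \<and>
     (\<forall>a b x y. x + a + y = b + y \<longrightarrow> l x \<ge> min (l a) (l b))"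

definition fuzzy_meet :: "('a \<Rightarrow> real) \<Rightarrow> ('a \<Rightarrow> real) \<Rightarrow> 'a \<Rightarrow> real" (infixl "\<and>\<^sub>f" 70) where
  "(mu \<and>\<^sub>f nu) = (\<lambda>x. min (mu x) (nu x))"

text \<open>
  The families are given by functions on \<^typ>\<open>nat\<close> of which only the values on
  \<open>{1..m}\<close> and \<open>{1..n}\<close> are used. Since \<open>1 \<le> m\<close> and \<open>1 \<le> n\<close>, the minima range over
  nonempty sets.
\<close>

definition h_product_values ::
  "('a::semiring_0 \<Rightarrow> real) \<Rightarrow> ('a \<Rightarrow> real) \<Rightarrow> 'a \<Rightarrow> real set" where
  "h_product_values mu nu x =
     {min (MIN i\<in>{1..m}. min (mu (a i)) (nu (b i)))
          (MIN j\<in>{1..n}. min (mu (a' j)) (nu (b' j))) | m n a b a' b' z.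
        1 \<le> (m::nat) \<and> 1 \<le> (n::nat) \<and>
        x + (\<Sum>i=1..m. a i * b i) + z = (\<Sum>j=1..n. a' j * b' j) + z}"

text \<open>
  For fuzzy subsets the values are bounded by 1, so the real supremum is the true one; the empty
  case must be separated because \<open>Sup {}\<close> is unspecified on the reals.
\<close>

definition h_product ::
  "('a::semiring_0 \<Rightarrow> real) \<Rightarrow> ('a \<Rightarrow> real) \<Rightarrow> 'a \<Rightarrow> real" (infixl "\<odot>\<^sub>h" 70) where
  "(mu \<odot>\<^sub>h nu) = (\<lambda>x. if h_product_values mu nu x = {} then 0
                       else Sup (h_product_values mu nu x))"

end

theory Submission
  imports Defs
begin

text \<open>
  For fuzzy \<open>h\<close>-ideals the product always lies below the meet. Conversely, the meet of two
  fuzzy \<open>h\<close>-ideals is again one, so if it is idempotent, then monotonicity of the product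
  places it below the product of the two.
\<close>

text \<open>Each closure condition bounds a value from below by one value or by a minimum of two,
  and such bounds survive pointwise minima. This makes idempotence applicable to the meet.\<close>

lemma fuzzy_h_ideal_meet:
  assumes "fuzzy_h_ideal l" "fuzzy_h_ideal mu"
  shows "fuzzy_h_ideal (l \<and>\<^sub>f mu)"
  using assms unfolding fuzzy_h_ideal_def fuzzy_subset_def fuzzy_meet_def
  by (auto simp: min_le_iff_disj) (meson order_trans)+

lemma fuzzy_h_ideal_mult:
  assumes "fuzzy_h_ideal l"
  shows "l a \<le> l (a * b)" and "l b \<le> l (a * b)"
  using assms unfolding fuzzy_h_ideal_def by blast+

text \<open>The level set of \<open>l\<close> at \<open>v\<close> is closed under addition. The
  induction starts at one summand: the empty sum is 0, and vacuous assumptions would not give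
  \<open>v \<le> l 0\<close>.\<close>

lemma fuzzy_h_ideal_sum:
  assumes l: "fuzzy_h_ideal l" and "1 \<le> (m::nat)"
    and "\<And>i. i \<in> {1..m} \<Longrightarrow> v \<le> l (c i)"
  shows "v \<le> l (\<Sum>i=1..m. c i)"
  using assms(2,3)
proof (induction m rule: nat_induct_at_least)
  case base
  then show ?case by simp
next
  case (Suc m)
  have "v \<le> min (l (\<Sum>i=1..m. c i)) (l (c (Suc m)))"
    using Suc by simp
  also have "\<dots> \<le> l ((\<Sum>i=1..m. c i) + c (Suc m))"
    using l unfolding fuzzy_h_ideal_def by blast
  finally show ?case by simp
qed

text \<open>In an expression of value \<open>v\<close>, all left factors lie in the level set of
  \<open>l\<close> at \<open>v\<close> and all right factors in that of \<open>mu\<close>.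
  Absorption puts every product into both level sets, hence both sums, and the
  \<open>h\<close>-condition then passes to \<open>x\<close>.\<close>

lemma h_product_values_le_meet:
  assumes l: "fuzzy_h_ideal l" and mu: "fuzzy_h_ideal mu"
    and "v \<in> h_product_values l mu x"
  shows "v \<le> (l \<and>\<^sub>f mu) x"
proof -
  from assms(3) obtain m n a b a' b' z where
    v: "v = min (MIN i\<in>{1..m}. min (l (a i)) (mu (b i)))
                (MIN j\<in>{1..n}. min (l (a' j)) (mu (b' j)))"
    and mn: "1 \<le> (m::nat)" "1 \<le> (n::nat)"
    and eq: "x + (\<Sum>i=1..m. a i * b i) + z = (\<Sum>j=1..n. a' j * b' j) + z"
    unfolding h_product_values_def by blast
  have ab: "v \<le> l (a i)" "v \<le> mu (b i)" if "i \<in> {1..m}" for i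
    using that Min_le[of "(\<lambda>i. min (l (a i)) (mu (b i))) ` {1..m}" "min (l (a i)) (mu (b i))"]
    unfolding v by auto
  have ab': "v \<le> l (a' j)" "v \<le> mu (b' j)" if "j \<in> {1..n}" for j
    using that Min_le[of "(\<lambda>j. min (l (a' j)) (mu (b' j))) ` {1..n}" "min (l (a' j)) (mu (b' j))"]
    unfolding v by auto
  \<comment> \<open>Stated for a general \<open>f\<close> because it serves twice: for
    \<open>l\<close> through the left factors and for \<open>mu\<close> through the right
    ones.\<close>
  have below: "v \<le> f x"
    if f: "fuzzy_h_ideal f"
      and "\<And>i. i \<in> {1..m} \<Longrightarrow> v \<le> f (a i * b i)"
      and "\<And>j. j \<in> {1..n} \<Longrightarrow> v \<le> f (a' j * b' j)" for f
  proof -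
    have "v \<le> min (f (\<Sum>i=1..m. a i * b i)) (f (\<Sum>j=1..n. a' j * b' j))"
      by (intro min.boundedI fuzzy_h_ideal_sum[OF f] mn that(2,3))
    \<comment> \<open>The \<open>h\<close>-condition, with the two sums as \<open>a\<close> and
      \<open>b\<close> and with \<open>z\<close> as \<open>y\<close>.\<close>
    also have "\<dots> \<le> f x"
      using f eq unfolding fuzzy_h_ideal_def by blast
    finally show ?thesis .
  qed
  have "v \<le> l x"
    by (rule below[OF l])
      (erule order_trans[OF ab(1) fuzzy_h_ideal_mult(1)[OF l]]
         order_trans[OF ab'(1) fuzzy_h_ideal_mult(1)[OF l]])+
  moreover have "v \<le> mu x"
    by (rule below[OF mu])
      (erule order_trans[OF ab(2) fuzzy_h_ideal_mult(2)[OF mu]]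
         order_trans[OF ab'(2) fuzzy_h_ideal_mult(2)[OF mu]])+
  ultimately show ?thesis
    by (simp add: fuzzy_meet_def)
qed

lemma h_product_le_meet:
  assumes "fuzzy_h_ideal l" "fuzzy_h_ideal mu"
  shows "(l \<odot>\<^sub>h mu) x \<le> (l \<and>\<^sub>f mu) x"
proof (cases "h_product_values l mu x = {}")
  case True
  \<comment> \<open>The default value 0 lies below the meet since fuzzy subsets are
    nonnegative.\<close>
  then show ?thesis
    using assms by (simp add: h_product_def fuzzy_meet_def fuzzy_h_ideal_def fuzzy_subset_def)
next
  case False
  then show ?thesis
    using assms by (auto simp: h_product_def intro!: cSup_least h_product_values_le_meet)
qed

lemma h_product_values_mono:
  assumes le: "\<And>y. mu y \<le> mu' y" "\<And>y. nu y \<le> nu' y"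
    and "v \<in> h_product_values mu nu x"
  shows "\<exists>w \<in> h_product_values mu' nu' x. v \<le> w"
proof -
  from assms(3) obtain m n a b a' b' z where
    v: "v = min (MIN i\<in>{1..m}. min (mu (a i)) (nu (b i)))
                (MIN j\<in>{1..n}. min (mu (a' j)) (nu (b' j)))"
    and mn: "1 \<le> (m::nat)" "1 \<le> (n::nat)"
    and eq: "x + (\<Sum>i=1..m. a i * b i) + z = (\<Sum>j=1..n. a' j * b' j) + z"
    unfolding h_product_values_def by blast
  have Min_mono: "(MIN i\<in>{1..k}. min (mu (c i)) (nu (d i))) \<le> (MIN i\<in>{1..k}. min (mu' (c i)) (nu' (d i)))"
    if "1 \<le> k" for k :: nat and c d
  proof (rule Min.boundedI)
    fix r assume "r \<in> (\<lambda>i. min (mu' (c i)) (nu' (d i))) ` {1..k}"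
    then obtain i where i: "i \<in> {1..k}" and r: "r = min (mu' (c i)) (nu' (d i))"
      by blast
    have "(MIN i\<in>{1..k}. min (mu (c i)) (nu (d i))) \<le> min (mu (c i)) (nu (d i))"
      using i by (intro Min_le) auto
    also have "\<dots> \<le> r"
      unfolding r by (intro min.mono le)
    finally show "(MIN i\<in>{1..k}. min (mu (c i)) (nu (d i))) \<le> r" .
  qed (use that in auto)
  \<comment> \<open>The same expression for \<open>x\<close>, now evaluated with the larger
    functions.\<close>
  let ?w = "min (MIN i\<in>{1..m}. min (mu' (a i)) (nu' (b i)))
                (MIN j\<in>{1..n}. min (mu' (a' j)) (nu' (b' j)))"
  have "?w \<in> h_product_values mu' nu' x"
    unfolding h_product_values_def using mn eq by blast
  moreover have "v \<le> ?w"
    unfolding v by (intro min.mono Min_mono mn)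
  ultimately show ?thesis by blast
qed

text \<open>Whether \<open>x\<close> admits an expression depends on the hemiring alone, so any two
  products take the same branch of the case distinction at \<open>x\<close>.\<close>

lemma h_product_values_empty_cong:
  assumes "h_product_values mu nu x = {}"
  shows "h_product_values mu' nu' x = {}"
proof (rule ccontr)
  assume "h_product_values mu' nu' x \<noteq> {}"
  then obtain m n a b a' b' z where
    mn: "1 \<le> (m::nat)" "1 \<le> (n::nat)"
    and eq: "x + (\<Sum>i=1..m. a i * b i) + z = (\<Sum>j=1..n. a' j * b' j) + z"
    unfolding h_product_values_def by blast
  have "min (MIN i\<in>{1..m}. min (mu (a i)) (nu (b i)))
            (MIN j\<in>{1..n}. min (mu (a' j)) (nu (b' j))) \<in> h_product_values mu nu x"
    unfolding h_product_values_def using mn eq by blast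
  with assms show False by simp
qed

text \<open>The functions are arbitrary real-valued ones here, so boundedness of the larger value
  set is assumed to make its \<open>Sup\<close> a true supremum.\<close>

lemma h_product_mono:
  assumes le: "\<And>y. mu y \<le> mu' y" "\<And>y. nu y \<le> nu' y"
    and bdd: "bdd_above (h_product_values mu' nu' x)"
  shows "(mu \<odot>\<^sub>h nu) x \<le> (mu' \<odot>\<^sub>h nu') x"
proof -
  have "h_product_values mu nu x = {} \<longleftrightarrow> h_product_values mu' nu' x = {}"
    by (intro iffI; erule h_product_values_empty_cong)
  moreover have "Sup (h_product_values mu nu x) \<le> Sup (h_product_values mu' nu' x)"
    if "h_product_values mu nu x \<noteq> {}"
    using that bdd h_product_values_mono[of mu mu' nu nu', OF le] by (rule cSup_mono)
  ultimately show ?thesis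
    by (simp add: h_product_def)
qed

theorem proposition4p3:
  "(\<forall>l :: 'a::semiring_0 \<Rightarrow> real. fuzzy_h_ideal l \<longrightarrow> l \<odot>\<^sub>h l = l) \<longleftrightarrow>
   (\<forall>(l :: 'a \<Rightarrow> real) (mu :: 'a \<Rightarrow> real).
      fuzzy_h_ideal l \<and> fuzzy_h_ideal mu \<longrightarrow> l \<odot>\<^sub>h mu = l \<and>\<^sub>f mu)"
proof (intro iffI allI impI)
  fix l mu :: "'a \<Rightarrow> real"
  assume idem: "\<forall>l :: 'a \<Rightarrow> real. fuzzy_h_ideal l \<longrightarrow> l \<odot>\<^sub>h l = l"
    and "fuzzy_h_ideal l \<and> fuzzy_h_ideal mu"
  then have l: "fuzzy_h_ideal l" and mu: "fuzzy_h_ideal mu" by auto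
  show "l \<odot>\<^sub>h mu = l \<and>\<^sub>f mu"
  proof (intro ext antisym h_product_le_meet l mu)
    fix x
    let ?k = "l \<and>\<^sub>f mu"
    have "?k x = (?k \<odot>\<^sub>h ?k) x"
      using idem fuzzy_h_ideal_meet[OF l mu] by simp
    also have "\<dots> \<le> (l \<odot>\<^sub>h mu) x"
    \<comment> \<open>The left copy of the meet is enlarged to \<open>l\<close>, the right copy to
      \<open>mu\<close>.\<close>
    proof (rule h_product_mono)
      \<comment> \<open>The value of the meet at \<open>x\<close> is an upper bound.\<close>
      show "bdd_above (h_product_values l mu x)"
        using h_product_values_le_meet[OF l mu] by (intro bdd_aboveI)
    qed (auto simp: fuzzy_meet_def)
    finally show "?k x \<le> (l \<odot>\<^sub>h mu) x" .
  qed
next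
  fix l :: "'a \<Rightarrow> real"
  assume "\<forall>(l :: 'a \<Rightarrow> real) (mu :: 'a \<Rightarrow> real).
      fuzzy_h_ideal l \<and> fuzzy_h_ideal mu \<longrightarrow> l \<odot>\<^sub>h mu = l \<and>\<^sub>f mu" "fuzzy_h_ideal l"
  \<comment> \<open>Take \<open>mu\<close> to be \<open>l\<close>; the meet of \<open>l\<close> with
    itself is \<open>l\<close>.\<close>
  then show "l \<odot>\<^sub>h l = l"
    by (simp add: fuzzy_meet_def)
qed

end
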